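(* Let $(\mathcal{K},\oplus,\cdot)$ be an abstract convex cone and let $m>0$. Let $K,E\in\mathcal{K}$ with $K,E\neq\boldsymbol{0}$, and let $\mathcal{F}:\mathcal{K}\to\mathbb{R}_{\geqslant 0}$ be a positive $m$-homogeneous functional such that: (i) $\mathcal{F}$ is $(1/m)$-convex on $\mathcal{K}_{K;E}$; (ii) its first variation $\mathcal{G}_E$ relative to $E$ is positive on $\mathcal{K}_{K;E}$. Then, for all $\lambda\in[0,1]$, $$\frac{\mathcal{F}\bigl((1-\lambda)\cdot K\oplus \lambda\cdot E\bigr)}{\mathcal{G}_E\bigl((1-\lambda)\cdot K\oplus \lambda\cdot E\bigr)}\leqslant (1-\lambda)\,\frac{\mathcal{F}(K)}{\mathcal{G}_E(K)}+\lambda\,\frac{\mathcal{F}(E)}{\mathcal{G}_E(E)}.$$ Equality holds for some $\lambda\in(0,1)$ if and only if the function $t\mapsto\mathcal{F}\bigl((1-t)\cdot K\oplus t\cdot E\bigr)^{1/m}$ is affine on $[0,\lambda]$.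
   Context: An abstract convex cone $(\mathcal{K},\oplus,\cdot)$ is a commutative semigroup $(\mathcal{K},\oplus)$ with additive identity $\boldsymbol{0}$ and a scalar multiplication $(r,K)\mapsto r\cdot K$ by real numbers $r\geqslant 0$ such that, for all $K,E\in\mathcal{K}$ and $r,s\geqslant 0$: $r\cdot(K\oplus E)=r\cdot K\oplus r\cdot E$, $(r+s)\cdot K=r\cdot K\oplus s\cdot K$, $(rs)\cdot K=r\cdot(s\cdot K)$, $1\cdot K=K$. It is also assumed that $0\cdot K=\boldsymbol{0}=r\cdot\boldsymbol{0}$, and that $K\oplus E\neq\boldsymbol{0}$ whenever $K,E\neq\boldsymbol{0}$. For $K,E\neq\boldsymbol{0}$, $\mathcal{K}_{K;E}=\{r\cdot K\oplus s\cdot E: r,s\geqslant 0,\ r+s>0\}$. A functional $\mathcal{F}:\mathcal{K}\to\mathbb{R}_{\geqslant 0}$ is positive if $\mathcal{F}(L)>0$ for all $L\neq\boldsymbol{0}$; it is $m$-homogeneous if $\mathcal{F}(r\cdot L)=r^m\mathcal{F}(L)$ for all $L\in\mathcal{K}$, $r\geqslant 0$. It is $(1/m)$-convex on $\mathcal{K}_{K;E}$ if $\mathcal{F}((1-t)\cdot L\oplus t\cdot M)^{1/m}\leqslant(1-t)\mathcal{F}(L)^{1/m}+t\mathcal{F}(M)^{1/m}$ for all $L,M\in\mathcal{K}_{K;E}$ and $t\in[0,1]$. The first variation of $\mathcal{F}$ relative to $E$ is $\mathcal{G}_E(L)=\lim_{t\to0^+}\frac{\mathcal{F}(L\oplus t\cdot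 E)-\mathcal{F}(L)}{t}$, provided the limit exists (possibly $\pm\infty$).
   Formalization: Equality at λ is shown to imply affinity on [0,λ]; conversely affinity on [0,λ] is shown to give equality only for parameters in (0,λ), since equality at λ itself can fail (e.g. F(a,b)=max(a+b,a/2+3b/2), λ=1/2). *)

theory Defs
  imports "HOL-Library.Extended_Real"
begin

text \<open>
  The cone is a carrier set \<open>C\<close> inside a type, so that every assumption on
  the operations is relativised to \<open>C\<close> and to scalars \<open>r \<ge> 0\<close>.
\<close>

locale abstract_convex_cone =
  fixes C :: "'a set"
    and add :: "'a \<Rightarrow> 'a \<Rightarrow> 'a"  (infixl "\<oplus>" 65)
    and zero :: "'a"  ("\<zero>")
    and smul :: "real \<Rightarrow> 'a \<Rightarrow> 'a"  (infixr "\<odot>" 75)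
  assumes add_closed: "\<lbrakk>K \<in> C; E \<in> C\<rbrakk> \<Longrightarrow> K \<oplus> E \<in> C"
    and add_assoc: "\<lbrakk>K \<in> C; E \<in> C; L \<in> C\<rbrakk> \<Longrightarrow> (K \<oplus> E) \<oplus> L = K \<oplus> (E \<oplus> L)"
    and add_commute: "\<lbrakk>K \<in> C; E \<in> C\<rbrakk> \<Longrightarrow> K \<oplus> E = E \<oplus> K"
    and zero_closed: "\<zero> \<in> C"
    and add_zero: "K \<in> C \<Longrightarrow> K \<oplus> \<zero> = K"
    and smul_closed: "\<lbrakk>0 \<le> r; K \<in> C\<rbrakk> \<Longrightarrow> r \<odot> K \<in> C"
    and smul_add: "\<lbrakk>0 \<le> r; K \<in> C; E \<in> C\<rbrakk> \<Longrightarrow> r \<odot> (K \<oplus> E) = r \<odot> K \<oplus> r \<odot> E"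
    and add_smul: "\<lbrakk>0 \<le> r; 0 \<le> s; K \<in> C\<rbrakk> \<Longrightarrow> (r + s) \<odot> K = r \<odot> K \<oplus> s \<odot> K"
    and smul_smul: "\<lbrakk>0 \<le> r; 0 \<le> s; K \<in> C\<rbrakk> \<Longrightarrow> (r * s) \<odot> K = r \<odot> (s \<odot> K)"
    and one_smul: "K \<in> C \<Longrightarrow> 1 \<odot> K = K"
    and zero_smul: "K \<in> C \<Longrightarrow> 0 \<odot> K = \<zero>"
    and smul_zero: "0 \<le> r \<Longrightarrow> r \<odot> \<zero> = \<zero>"
    and add_nonzero: "\<lbrakk>K \<in> C; E \<in> C; K \<noteq> \<zero>; E \<noteq> \<zero>\<rbrakk> \<Longrightarrow> K \<oplus> E \<noteq> \<zero>"

definition subcone2 ::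
    "('a \<Rightarrow> 'a \<Rightarrow> 'a) \<Rightarrow> (real \<Rightarrow> 'a \<Rightarrow> 'a) \<Rightarrow> 'a \<Rightarrow> 'a \<Rightarrow> 'a set" where
  "subcone2 add smul K E = {add (smul r K) (smul s E) | r s. 0 \<le> r \<and> 0 \<le> s \<and> 0 < r + s}"

definition positive_functional :: "'a set \<Rightarrow> 'a \<Rightarrow> ('a \<Rightarrow> real) \<Rightarrow> bool" where
  "positive_functional C zero F \<longleftrightarrow>
     (\<forall>L\<in>C. 0 \<le> F L) \<and> (\<forall>L\<in>C. L \<noteq> zero \<longrightarrow> 0 < F L)"

text \<open>For \<open>m > 0\<close> the library convention \<open>0 powr m = 0\<close> is the intended one.\<close>

definition homogeneous ::
    "'a set \<Rightarrow> (real \<Rightarrow> 'a \<Rightarrow> 'a) \<Rightarrow> real \<Rightarrow> ('a \<Rightarrow> real) \<Rightarrow> bool" where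
  "homogeneous C smul m F \<longleftrightarrow> (\<forall>L\<in>C. \<forall>r\<ge>0. F (smul r L) = r powr m * F L)"

definition root_convex_on ::
    "('a \<Rightarrow> 'a \<Rightarrow> 'a) \<Rightarrow> (real \<Rightarrow> 'a \<Rightarrow> 'a) \<Rightarrow> real \<Rightarrow> 'a set \<Rightarrow> ('a \<Rightarrow> real) \<Rightarrow> bool" where
  "root_convex_on add smul m S F \<longleftrightarrow>
     (\<forall>L\<in>S. \<forall>M\<in>S. \<forall>t\<in>{0..1}.
        F (add (smul (1 - t) L) (smul t M)) powr (1 / m)
          \<le> (1 - t) * F L powr (1 / m) + t * F M powr (1 / m))"

definition variation_quotient ::
    "('a \<Rightarrow> 'a \<Rightarrow> 'a) \<Rightarrow> (real \<Rightarrow> 'a \<Rightarrow> 'a) \<Rightarrow> ('a \<Rightarrow> real) \<Rightarrow> 'a \<Rightarrow> 'a \<Rightarrow> real \<Rightarrow> ereal" where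
  "variation_quotient add smul F E L t = ereal ((F (add L (smul t E)) - F L) / t)"

text \<open>
  The limit is taken in the extended reals, so the values \<open>\<plusminus>\<infinity>\<close> are allowed.
  \<open>first_variation\<close> is meaningful only when \<open>has_first_variation\<close> holds.
\<close>

definition has_first_variation ::
    "('a \<Rightarrow> 'a \<Rightarrow> 'a) \<Rightarrow> (real \<Rightarrow> 'a \<Rightarrow> 'a) \<Rightarrow> ('a \<Rightarrow> real) \<Rightarrow> 'a \<Rightarrow> 'a \<Rightarrow> bool" where
  "has_first_variation add smul F E L \<longleftrightarrow>
     (\<exists>g. (variation_quotient add smul F E L \<longlongrightarrow> g) (at_right 0))"

definition first_variation ::
    "('a \<Rightarrow> 'a \<Rightarrow> 'a) \<Rightarrow> (real \<Rightarrow> 'a \<Rightarrow> 'a) \<Rightarrow> ('a \<Rightarrow> real) \<Rightarrow> 'a \<Rightarrow> 'a \<Rightarrow> ereal" where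
  "first_variation add smul F E L = Lim (at_right 0) (variation_quotient add smul F E L)"

definition affine_fun_on :: "real set \<Rightarrow> (real \<Rightarrow> real) \<Rightarrow> bool" where
  "affine_fun_on S f \<longleftrightarrow> (\<exists>a b. \<forall>t\<in>S. f t = a + b * t)"

end

theory Submission
  imports Defs "HOL-Analysis.Convex"
begin

text \<open>
  The function \<open>h(u) = F(K \<oplus> u \<odot> E)\<^sup>1\<^sup>/\<^sup>m\<close> is convex on \<open>[0,\<infinity>)\<close>, and by homogeneity the ratio
  of \<open>F\<close> to its first variation at \<open>(1 - l) \<odot> K \<oplus> l \<odot> E\<close> is \<open>(1 - l) h(s) / (m h'(s))\<close>, where
  \<open>s = l / (1 - l)\<close> and \<open>h'\<close> is the right derivative; at \<open>E\<close> it is \<open>1 / m\<close>. The inequality thus reads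
  \<open>h(s) / h'(s) \<le> h(0) / h'(0) + s\<close>. It follows from \<open>h'(0) \<le> (h(s) - h(0)) / s \<le> h'(s)\<close>,
  with equality exactly when the three slopes agree, that is, when \<open>h\<close> is affine on \<open>[0,s]\<close>
  and continues to the right of \<open>s\<close> with the same slope.
\<close>

section \<open>Chord slopes and right derivatives of convex functions\<close>

text \<open>The chord slopes from \<open>x\<close> to \<open>t\<close> are nondecreasing in
  \<open>t\<close>, so their limit as \<open>t\<close> decreases to \<open>x\<close> stays below the
  slope to \<open>y\<close>.\<close>

lemma convex_on_right_derivative_le_slope:
  fixes h :: "real \<Rightarrow> real"
  assumes h: "convex_on I h" and I: "x \<in> I" "y \<in> I" and xy: "x < y"
    and d: "(h has_real_derivative d) (at_right x)"
  shows "d \<le> (h y - h x) / (y - x)"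
proof (rule tendsto_upperbound)
  show "((\<lambda>t. (h t - h x) / (t - x)) \<longlongrightarrow> d) (at_right x)"
    using d by (simp add: has_field_derivative_iff)
  have "(h t - h x) / (t - x) \<le> (h y - h x) / (y - x)" if "x < t" "t < y" for t
    using convex_on_slope_le(1)[OF h I that] by (smt (verit) minus_divide_divide)
  then show "\<forall>\<^sub>F t in at_right x. (h t - h x) / (t - x) \<le> (h y - h x) / (y - x)"
    using xy by (auto simp: eventually_at_right_field)
qed simp

text \<open>Slopes of adjacent chords increase, so the slope over \<open>[x, y]\<close> bounds every
  quotient to the right of \<open>y\<close> from below, and hence their limit.\<close>

lemma convex_on_slope_le_right_derivative:
  fixes h :: "real \<Rightarrow> real"
  assumes h: "convex_on {0..} h" and xy: "0 \<le> x" "x < y"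
    and d: "(h has_real_derivative d) (at_right y)"
  shows "(h y - h x) / (y - x) \<le> d"
proof (rule tendsto_lowerbound)
  show "((\<lambda>t. (h t - h y) / (t - y)) \<longlongrightarrow> d) (at_right y)"
    using d by (simp add: has_field_derivative_iff)
  have "(h y - h x) / (y - x) \<le> (h t - h y) / (t - y)" if t: "y < t" for t
  proof -
    have "x \<in> {0..}" "t \<in> {0..}"
      using xy t by auto
    from convex_on_slope_le[OF h this xy(2) t]
    have "(h x - h y) / (x - y) \<le> (h y - h t) / (y - t)"
      by linarith
    then show ?thesis
      by (smt (verit) minus_divide_divide)
  qed
  then show "\<forall>\<^sub>F t in at_right y. (h y - h x) / (y - x) \<le> (h t - h y) / (t - y)"
    by (auto simp: eventually_at_right_field intro: exI[of _ "y + 1"])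
qed simp

text \<open>
  A nonpositive difference quotient of \<open>H\<close> would, by monotonicity of slopes, force a
  nonpositive variation. So the slopes decrease to a finite limit, and in particular the
  jump at \<open>0\<close> that convexity alone would permit does not occur.
\<close>

lemma convex_on_positive_variation:
  fixes H :: "real \<Rightarrow> real"
  assumes H: "convex_on {0..} H" and H_pos: "\<And>t. 0 \<le> t \<Longrightarrow> 0 < H t" and m: "0 < m"
    and lim: "((\<lambda>t. ereal ((H t powr m - H 0 powr m) / t)) \<longlongrightarrow> g) (at_right 0)"
    and g: "0 < g"
  obtains d where "0 < d" and "(H has_real_derivative d) (at_right 0)"
    and "ereal (H 0 powr m) / g = ereal (H 0 / (m * d))"
proof -
  define q where "q t = (H t - H 0) / t" for t
  have q_mono: "q s \<le> q t" if st: "0 < s" "s \<le> t" for s t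
  proof (cases "s = t")
    case False
    then have "s < t" "(0::real) \<in> {0..}" "t \<in> {0..}"
      using st by auto
    from convex_on_slope_le(1)[OF H this(2,3) st(1) this(1)]
    show ?thesis
      unfolding q_def by (smt (verit) minus_divide_divide)
  qed simp
  have q_pos: "0 < q t" if t: "0 < t" for t
  proof (rule ccontr)
    assume "\<not> 0 < q t"
    have "(H s powr m - H 0 powr m) / s \<le> 0" if s: "0 < s" "s < t" for s
    proof -
      have "q s \<le> 0"
        using q_mono[of s t] s \<open>\<not> 0 < q t\<close> by linarith
      then have "H s \<le> H 0"
        using s by (simp add: q_def divide_le_0_iff)
      then have "H s powr m \<le> H 0 powr m"
        using H_pos[of s] s m by (intro powr_mono2) auto
      then show ?thesis
        using s by (simp add: divide_le_0_iff)
    qed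
    then have "\<forall>\<^sub>F s in at_right 0. ereal ((H s powr m - H 0 powr m) / s) \<le> 0"
      using t by (auto simp: eventually_at_right_field)
    then have "g \<le> 0"
      using tendsto_upperbound[OF lim] by simp
    with g show False
      by simp
  qed
  \<comment> \<open>A quotient that is monotone and bounded below converges at \<open>0\<close> from
    the right to its infimum.\<close>
  define d where "d = (INF t\<in>{0<..}. q t)"
  have bdd: "bdd_below (q ` {0<..})"
    using q_pos by (intro bdd_belowI[of _ 0]) (auto intro: less_imp_le)
  have "(q \<longlongrightarrow> d) (at_right 0)"
  proof (rule order_tendstoI)
    fix a assume "a < d"
    have "d \<le> q t" if "0 < t" for t
      unfolding d_def by (rule cINF_lower[OF bdd]) (use that in auto)
    with \<open>a < d\<close> show "\<forall>\<^sub>F t in at_right 0. a < q t"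
      by (auto simp: eventually_at_right_field intro!: exI[of _ 1] intro: less_le_trans)
  next
    fix a assume "d < a"
    then obtain t where t: "0 < t" "q t < a"
      using bdd unfolding d_def by (subst (asm) cINF_less_iff) auto
    then show "\<forall>\<^sub>F t in at_right 0. q t < a"
      using q_mono by (auto simp: eventually_at_right_field intro!: exI[of _ t] intro: le_less_trans less_imp_le)
  qed
  then have deriv: "(H has_real_derivative d) (at_right 0)"
    by (simp add: has_field_derivative_iff q_def[abs_def])
  \<comment> \<open>The chain rule computes the variation a second time, so uniqueness of limits
    identifies \<open>g\<close> and shows that it is finite.\<close>
  have "((\<lambda>t. H t powr m) has_real_derivative m * H 0 powr (m - 1) * d) (at_right 0)"
    by (rule DERIV_chain2[where f = "\<lambda>z. z powr m", OF has_real_derivative_powr deriv]) (simp add: H_pos)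
  then have "((\<lambda>t. ereal ((H t powr m - H 0 powr m) / t)) \<longlongrightarrow> ereal (m * H 0 powr (m - 1) * d))
      (at_right 0)"
    by (simp add: has_field_derivative_iff)
  with lim have g_eq: "g = ereal (m * H 0 powr (m - 1) * d)"
    by (intro tendsto_unique[of "at_right 0"]) auto
  have H0: "0 < H 0"
    using H_pos by simp
  \<comment> \<open>An infimum of positive quotients is only known to be nonnegative; strictness
    comes from \<open>0 < g\<close>.\<close>
  have d_pos: "0 < d"
    by (rule zero_less_mult_pos[of "m * H 0 powr (m - 1)"]) (use g m H0 in \<open>auto simp: g_eq\<close>)
  have "H 0 powr m = H 0 * H 0 powr (m - 1)"
    using H0 by (simp add: powr_diff)
  then have "ereal (H 0 powr m) / g = ereal (H 0 / (m * d))"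
    using m H0 d_pos unfolding g_eq by simp
  with d_pos deriv show thesis
    by (rule that)
qed

text \<open>With \<open>k\<close> the slope of the chord over \<open>[0, s]\<close>,
  \<open>h s / ds\<close> splits into \<open>h 0 / ds + k / ds * s\<close>, and
  \<open>d0 \<le> k \<le> ds\<close> bounds each summand separately; equality forces both bounds to
  be attained. Geometrically, the zero of the right tangent does not move left when the point of
  contact moves from \<open>0\<close> to \<open>s\<close>.\<close>

lemma convex_on_tangent_ratio_le:
  fixes h :: "real \<Rightarrow> real"
  assumes h: "convex_on {0..} h" and h_pos: "\<And>t. 0 \<le> t \<Longrightarrow> 0 < h t" and s: "0 < s"
    and d0: "(h has_real_derivative d0) (at_right 0)" "0 < d0"
    and ds: "(h has_real_derivative ds) (at_right s)"
  shows "h s / ds \<le> h 0 / d0 + s"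
    and "h s / ds = h 0 / d0 + s \<longleftrightarrow> (\<forall>u\<in>{0..s}. h u = h 0 + d0 * u) \<and> ds = d0"
proof -
  define k where "k = (h s - h 0) / s"
  have k: "d0 \<le> k" "k \<le> ds"
    using convex_on_right_derivative_le_slope[OF h _ _ s d0(1)] s
      convex_on_slope_le_right_derivative[OF h _ s ds] by (auto simp: k_def)
  have hs: "h s = h 0 + k * s"
    using s by (simp add: k_def)
  have h0: "0 < h 0"
    using h_pos by simp
  have pos: "0 < k" "0 < ds"
    using k d0 by auto
  have eq: "h s / ds = h 0 / ds + k / ds * s"
    by (simp add: hs add_divide_distrib)
  have le1: "h 0 / ds \<le> h 0 / d0"
    using k d0 h0 by (intro divide_left_mono) auto
  have le2: "k / ds * s \<le> s"
    using k pos s by (simp add: divide_le_eq mult.commute)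
  show "h s / ds \<le> h 0 / d0 + s"
    using eq le1 le2 by linarith
  show "h s / ds = h 0 / d0 + s \<longleftrightarrow> (\<forall>u\<in>{0..s}. h u = h 0 + d0 * u) \<and> ds = d0"
  proof
    assume "h s / ds = h 0 / d0 + s"
    then have "h 0 / ds = h 0 / d0" "k / ds * s = s"
      using eq le1 le2 by linarith+
    then have ds_eq: "ds = d0" and k_eq: "k = d0"
      using h0 pos d0 s by (auto simp: field_simps)
    \<comment> \<open>Convexity puts \<open>h\<close> below the chord and above the tangent at
      \<open>0\<close>; these now have the same slope.\<close>
    have "h u = h 0 + d0 * u" if u: "0 < u" "u < s" for u
    proof (rule antisym)
      have "(h 0 - h u) / (0 - u) \<le> (h 0 - h s) / (0 - s)"
        by (rule convex_on_slope_le(1)[OF h]) (use u in auto)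
      then have "(h u - h 0) / u \<le> k"
        by (simp add: k_def) (smt (verit) minus_divide_divide minus_divide_left)
      then show "h u \<le> h 0 + d0 * u"
        using u k_eq by (simp add: field_simps)
      have "d0 \<le> (h u - h 0) / (u - 0)"
        by (rule convex_on_right_derivative_le_slope[OF h _ _ _ d0(1)]) (use u in auto)
      then show "h 0 + d0 * u \<le> h u"
        using u by (simp add: field_simps)
    qed
    then have "h u = h 0 + d0 * u" if "u \<in> {0..s}" for u
      using that hs k_eq by (cases "u = 0 \<or> u = s") auto
    with ds_eq show "(\<forall>u\<in>{0..s}. h u = h 0 + d0 * u) \<and> ds = d0"
      by blast
  next
    assume "(\<forall>u\<in>{0..s}. h u = h 0 + d0 * u) \<and> ds = d0"
    then have "h s = h 0 + d0 * s" "ds = d0"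
      using s by (blast intro: less_imp_le atLeastAtMost_iff[THEN iffD2])+
    then show "h s / ds = h 0 / d0 + s"
      using d0 by (simp add: add_divide_distrib)
  qed
qed

section \<open>Combinations of two elements of an abstract convex cone\<close>

context abstract_convex_cone
begin

text \<open>Scaling by \<open>1 / r\<close> recovers \<open>K\<close>, yet keeps
  \<open>\<zero>\<close> fixed.\<close>

lemma smul_nonzero:
  assumes "0 < r" "K \<in> C" "K \<noteq> \<zero>"
  shows "r \<odot> K \<noteq> \<zero>"
proof
  assume "r \<odot> K = \<zero>"
  then have "(1 / r * r) \<odot> K = \<zero>"
    using assms by (subst smul_smul) (auto simp: smul_zero)
  then show False
    using assms by (simp add: one_smul)
qed

text \<open>\<open>add_nonzero\<close> speaks of nonzero summands, so a vanishing coefficient is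
  treated apart. The result gives strict positivity of \<open>F\<close> on the subcone.\<close>

lemma comb_nonzero:
  assumes "K \<in> C" "E \<in> C" "K \<noteq> \<zero>" "E \<noteq> \<zero>" "0 \<le> r" "0 \<le> s" "0 < r + s"
  shows "r \<odot> K \<oplus> s \<odot> E \<noteq> \<zero>"
proof (cases "r = 0 \<or> s = 0")
  case True
  then show ?thesis
  proof
    assume "r = 0"
    then show ?thesis
      using assms smul_nonzero[of s E]
      by (metis add_0 add_commute add_zero smul_closed zero_closed zero_smul)
  next
    assume "s = 0"
    then show ?thesis
      using assms smul_nonzero[of r K] by (simp add: zero_smul add_zero smul_closed)
  qed
next
  case False
  then show ?thesis
    using assms by (intro add_nonzero smul_closed smul_nonzero) auto
qed

lemma add_comb:
  assumes "K \<in> C" "E \<in> C" "0 \<le> a" "0 \<le> b" "0 \<le> c" "0 \<le> d"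
  shows "(a \<odot> K \<oplus> b \<odot> E) \<oplus> (c \<odot> K \<oplus> d \<odot> E) = (a + c) \<odot> K \<oplus> (b + d) \<odot> E"
proof -
  have cl: "a \<odot> K \<in> C" "b \<odot> E \<in> C" "c \<odot> K \<in> C" "d \<odot> E \<in> C"
    using assms by (auto intro: smul_closed)
  have "(a \<odot> K \<oplus> b \<odot> E) \<oplus> (c \<odot> K \<oplus> d \<odot> E) = a \<odot> K \<oplus> ((b \<odot> E \<oplus> c \<odot> K) \<oplus> d \<odot> E)"
    using cl by (simp add: add_assoc add_closed)
  also have "\<dots> = a \<odot> K \<oplus> ((c \<odot> K \<oplus> b \<odot> E) \<oplus> d \<odot> E)"
    using cl by (simp add: add_commute)
  also have "\<dots> = (a \<odot> K \<oplus> c \<odot> K) \<oplus> (b \<odot> E \<oplus> d \<odot> E)"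
    using cl by (simp add: add_assoc add_closed)
  finally show ?thesis
    using assms by (simp add: add_smul)
qed

lemma smul_comb:
  assumes "K \<in> C" "E \<in> C" "0 \<le> r" "0 \<le> a" "0 \<le> b"
  shows "r \<odot> (a \<odot> K \<oplus> b \<odot> E) = (r * a) \<odot> K \<oplus> (r * b) \<odot> E"
  using assms by (simp add: smul_add smul_closed smul_smul)

end

section \<open>The inequality and its equality case\<close>

text \<open>Affinity up to \<open>l\<close> yields equality only at \<open>k < l\<close>: equality
  at \<open>l\<close> also constrains the right derivative there, which depends on \<open>h\<close>
  beyond the interval. For \<open>m = 1\<close> and \<open>h u = max (1 + u) (2 * u)\<close> the
  function is affine up to \<open>l = 1 / 2\<close>, but the kink at \<open>u = 1\<close> makes the
  inequality strict at that \<open>l\<close>.\<close>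

theorem theorem3p2:
  fixes C :: "'a set"
    and add :: "'a \<Rightarrow> 'a \<Rightarrow> 'a"  (infixl "\<oplus>" 65)
    and zero :: "'a"  ("\<zero>")
    and smul :: "real \<Rightarrow> 'a \<Rightarrow> 'a"  (infixr "\<odot>" 75)
    and m :: real
    and K E :: 'a
    and F :: "'a \<Rightarrow> real"
  assumes cone: "abstract_convex_cone C (\<oplus>) \<zero> (\<odot>)"
    and m_pos: "0 < m"
    and K: "K \<in> C" "K \<noteq> \<zero>"
    and E: "E \<in> C" "E \<noteq> \<zero>"
    and F_pos: "positive_functional C \<zero> F"
    and F_hom: "homogeneous C (\<odot>) m F"
    and F_convex: "root_convex_on (\<oplus>) (\<odot>) m (subcone2 (\<oplus>) (\<odot>) K E) F"
    and G_pos: "\<forall>L \<in> subcone2 (\<oplus>) (\<odot>) K E.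
                  has_first_variation (\<oplus>) (\<odot>) F E L \<and> 0 < first_variation (\<oplus>) (\<odot>) F E L"
  shows
    "let G = first_variation (\<oplus>) (\<odot>) F E;
         P = (\<lambda>t. (1 - t) \<odot> K \<oplus> t \<odot> E);
         lhs = (\<lambda>t. ereal (F (P t)) / G (P t));
         rhs = (\<lambda>t. ereal (1 - t) * (ereal (F K) / G K) + ereal t * (ereal (F E) / G E));
         affine_upto = (\<lambda>l. affine_fun_on {0..l} (\<lambda>t. F (P t) powr (1 / m)))
     in (\<forall>l\<in>{0..1}. lhs l \<le> rhs l)
      \<and> ((\<exists>l\<in>{0<..<1}. lhs l = rhs l) \<longleftrightarrow> (\<exists>l\<in>{0<..<1}. affine_upto l))
      \<and> (\<forall>l\<in>{0<..<1}. lhs l = rhs l \<longrightarrow> affine_upto l)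
      \<and> (\<forall>l\<in>{0<..<1}. affine_upto l \<longrightarrow> (\<forall>k\<in>{0<..<l}. lhs k = rhs k))"
proof -
  interpret abstract_convex_cone C "(\<oplus>)" \<zero> "(\<odot>)"
    by (rule cone)
  define G where "G = first_variation (\<oplus>) (\<odot>) F E"
  \<comment> \<open>In the coordinates \<open>(a, b)\<close> along \<open>K\<close> and
    \<open>E\<close>, the root of \<open>F\<close> becomes \<open>\<phi>\<close>, homogeneous of
    degree one; \<open>h\<close> is its restriction to \<open>a = 1\<close>.\<close>
  define \<phi> where "\<phi> a b = F (a \<odot> K \<oplus> b \<odot> E) powr (1 / m)" for a b
  define h where "h = \<phi> 1"
  have comb_in: "a \<odot> K \<oplus> b \<odot> E \<in> C" if "0 \<le> a" "0 \<le> b" for a b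
    using that K E by (intro add_closed smul_closed)
  have comb_sub: "a \<odot> K \<oplus> b \<odot> E \<in> subcone2 (\<oplus>) (\<odot>) K E"
    if "0 \<le> a" "0 \<le> b" "0 < a + b" for a b
    unfolding subcone2_def using that by blast
  have F_comb_pos: "0 < F (a \<odot> K \<oplus> b \<odot> E)" if "0 \<le> a" "0 \<le> b" "0 < a + b" for a b
    using F_pos comb_in[OF that(1,2)] comb_nonzero[OF K(1) E(1) K(2) E(2) that]
    unfolding positive_functional_def by blast
  have F_eq: "F (a \<odot> K \<oplus> b \<odot> E) = \<phi> a b powr m" if "0 \<le> a" "0 \<le> b" "0 < a + b" for a b
    unfolding \<phi>_def using F_comb_pos[OF that] m_pos by (simp add: powr_powr)
  have \<phi>_pos: "0 < \<phi> a b" if "0 \<le> a" "0 \<le> b" "0 < a + b" for a b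
    unfolding \<phi>_def using F_comb_pos[OF that] by simp
  have \<phi>_hom: "\<phi> (r * a) (r * b) = r * \<phi> a b" if "0 \<le> r" "0 \<le> a" "0 \<le> b" for r a b
  proof -
    have "F ((r * a) \<odot> K \<oplus> (r * b) \<odot> E) = r powr m * F (a \<odot> K \<oplus> b \<odot> E)"
      using F_hom comb_in[of a b] that
      unfolding smul_comb[OF K(1) E(1) that, symmetric] homogeneous_def by blast
    moreover have "0 \<le> F (a \<odot> K \<oplus> b \<odot> E)"
      using F_pos comb_in[of a b] that unfolding positive_functional_def by blast
    ultimately show ?thesis
      unfolding \<phi>_def using that m_pos by (simp add: powr_mult powr_powr)
  qed
  \<comment> \<open>The base point \<open>b\<close> is shifted to \<open>0\<close>, where the first
    variation takes its limit; \<open>a = 0\<close> is included for the sake of the point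
    \<open>E\<close>.\<close>
  have \<phi>_convex: "convex_on {0..} (\<lambda>t. \<phi> a (b + t))" if ab: "0 \<le> a" "0 \<le> b" "0 < a + b" for a b
  proof (rule convex_onI)
    fix t x y :: real
    assume t: "0 < t" "t < 1" and xy: "x \<in> {0..}" "y \<in> {0..}"
    have "(1 - t) \<odot> (a \<odot> K \<oplus> (b + x) \<odot> E) \<oplus> t \<odot> (a \<odot> K \<oplus> (b + y) \<odot> E)
        = ((1 - t) * a + t * a) \<odot> K \<oplus> ((1 - t) * (b + x) + t * (b + y)) \<odot> E"
      using t xy ab K E by (simp add: smul_comb add_comb)
    also have "(1 - t) * a + t * a = a"
      by (simp add: algebra_simps)
    also have "(1 - t) * (b + x) + t * (b + y) = b + ((1 - t) *\<^sub>R x + t *\<^sub>R y)"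
      by (simp add: algebra_simps)
    finally have eq: "(1 - t) \<odot> (a \<odot> K \<oplus> (b + x) \<odot> E) \<oplus> t \<odot> (a \<odot> K \<oplus> (b + y) \<odot> E)
        = a \<odot> K \<oplus> (b + ((1 - t) *\<^sub>R x + t *\<^sub>R y)) \<odot> E" .
    have "a \<odot> K \<oplus> (b + x) \<odot> E \<in> subcone2 (\<oplus>) (\<odot>) K E"
      "a \<odot> K \<oplus> (b + y) \<odot> E \<in> subcone2 (\<oplus>) (\<odot>) K E" "t \<in> {0..1}"
      using t xy ab by (auto intro!: comb_sub)
    with F_convex have "F ((1 - t) \<odot> (a \<odot> K \<oplus> (b + x) \<odot> E) \<oplus> t \<odot> (a \<odot> K \<oplus> (b + y) \<odot> E)) powr (1 / m)
        \<le> (1 - t) * F (a \<odot> K \<oplus> (b + x) \<odot> E) powr (1 / m) + t * F (a \<odot> K \<oplus> (b + y) \<odot> E) powr (1 / m)"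
      unfolding root_convex_on_def by blast
    then show "\<phi> a (b + ((1 - t) *\<^sub>R x + t *\<^sub>R y)) \<le> (1 - t) * \<phi> a (b + x) + t * \<phi> a (b + y)"
      unfolding \<phi>_def eq .
  qed simp
  \<comment> \<open>Adding \<open>t \<odot> E\<close> moves only the second coefficient, so the
    first variation is that of \<open>\<phi> a (b + t) powr m\<close> at
    \<open>t = 0\<close>.\<close>
  have ratio: "\<exists>d>0. ((\<lambda>t. \<phi> a (b + t)) has_real_derivative d) (at_right 0) \<and>
      ereal (F (a \<odot> K \<oplus> b \<odot> E)) / G (a \<odot> K \<oplus> b \<odot> E) = ereal (\<phi> a b / (m * d))"
    if ab: "0 \<le> a" "0 \<le> b" "0 < a + b" for a b
  proof -
    let ?L = "a \<odot> K \<oplus> b \<odot> E"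
    from G_pos comb_sub[OF ab] obtain g
      where g: "(variation_quotient (\<oplus>) (\<odot>) F E ?L \<longlongrightarrow> g) (at_right 0)"
        and "0 < G ?L"
      unfolding has_first_variation_def G_def by blast
    moreover have G_eq: "G ?L = g"
      unfolding G_def first_variation_def using g by (intro tendsto_Lim) simp
    ultimately have "0 < g"
      by simp
    have "variation_quotient (\<oplus>) (\<odot>) F E ?L t
        = ereal ((\<phi> a (b + t) powr m - \<phi> a (b + 0) powr m) / t)" if t: "0 < t" for t
    proof -
      have "?L \<oplus> t \<odot> E = a \<odot> K \<oplus> (b + t) \<odot> E"
        using K E ab t by (simp add: add_assoc smul_closed add_smul)
      then show ?thesis
        unfolding variation_quotient_def using ab t by (simp add: F_eq)
    qed
    then have "\<forall>\<^sub>F t in at_right 0. variation_quotient (\<oplus>) (\<odot>) F E ?L t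
        = ereal ((\<phi> a (b + t) powr m - \<phi> a (b + 0) powr m) / t)"
      by (auto simp: eventually_at_right_field intro: exI[of _ 1])
    with g have "((\<lambda>t. ereal ((\<phi> a (b + t) powr m - \<phi> a (b + 0) powr m) / t)) \<longlongrightarrow> g) (at_right 0)"
      by (rule Lim_transform_eventually)
    then obtain d where "0 < d" "((\<lambda>t. \<phi> a (b + t)) has_real_derivative d) (at_right 0)"
      "ereal (\<phi> a (b + 0) powr m) / g = ereal (\<phi> a (b + 0) / (m * d))"
      using convex_on_positive_variation[OF \<phi>_convex[OF ab] _ m_pos _ \<open>0 < g\<close>] \<phi>_pos ab
      by (smt (verit))
    then show ?thesis
      using F_eq[OF ab] G_eq by auto
  qed
  have comb_K: "1 \<odot> K \<oplus> 0 \<odot> E = K"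
    using K E by (simp add: one_smul zero_smul add_zero)
  have comb_E: "0 \<odot> K \<oplus> 1 \<odot> E = E"
    using K E by (metis add_commute add_zero one_smul zero_closed zero_smul)
  have h_convex: "convex_on {0..} h"
    using \<phi>_convex[of 1 0] by (simp add: h_def)
  have h_pos: "0 < h t" if "0 \<le> t" for t
    using \<phi>_pos[of 1 t] that by (simp add: h_def)
  have \<phi>_h: "\<phi> a b = a * h (b / a)" if "0 < a" "0 \<le> b" for a b
    using \<phi>_hom[of a 1 "b / a"] that by (simp add: h_def)
  \<comment> \<open>The coordinates \<open>(0, 1)\<close> of \<open>E\<close> are out of reach of
    \<open>h\<close>, but by homogeneity \<open>\<phi>\<close> is linear along this ray, so its
    derivative equals its value at \<open>E\<close>.\<close>
  have E_ratio: "ereal (F E) / G E = ereal (1 / m)"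
  proof -
    obtain d where d: "0 < d" "((\<lambda>t. \<phi> 0 (1 + t)) has_real_derivative d) (at_right 0)"
      and eq: "ereal (F E) / G E = ereal (\<phi> 0 1 / (m * d))"
      using ratio[of 0 1] unfolding comb_E by auto
    have "\<phi> 0 (1 + t) = (1 + t) * \<phi> 0 1" if "0 < t" for t
      using \<phi>_hom[of "1 + t" 0 1] that by simp
    then have "\<forall>\<^sub>F t in at_right 0. \<phi> 0 (1 + t) = (1 + t) * \<phi> 0 1"
      by (auto simp: eventually_at_right_field intro: exI[of _ 1])
    then have "((\<lambda>t. (1 + t) * \<phi> 0 1) has_real_derivative d) (at_right 0)"
      using d(2) by (subst (asm) has_field_derivative_cong_eventually) auto
    moreover have "((\<lambda>t. (1 + t) * \<phi> 0 1) has_real_derivative \<phi> 0 1) (at_right 0)"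
      by (auto intro!: derivative_eq_intros)
    ultimately have "d = \<phi> 0 1"
      by (rule has_field_derivative_unique) simp
    then show ?thesis
      using eq d(1) by simp
  qed
  \<comment> \<open>By homogeneity \<open>\<phi> (1 - l)\<close> is a copy of \<open>h\<close>
    stretched by \<open>1 - l\<close> in both argument and value. The factors cancel in the
    derivative but not in the value.\<close>
  have ratio_h: "\<exists>d>0. (h has_real_derivative d) (at_right (l / (1 - l))) \<and>
      ereal (F ((1 - l) \<odot> K \<oplus> l \<odot> E)) / G ((1 - l) \<odot> K \<oplus> l \<odot> E)
        = ereal ((1 - l) / m * (h (l / (1 - l)) / d))"
    if l: "0 \<le> l" "l < 1" for l
  proof -
    define s where "s = l / (1 - l)"
    have l_eq: "l = (1 - l) * s"
      using l by (simp add: s_def)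
    obtain d where d: "0 < d" "((\<lambda>t. \<phi> (1 - l) (l + t)) has_real_derivative d) (at_right 0)"
      and eq: "ereal (F ((1 - l) \<odot> K \<oplus> l \<odot> E)) / G ((1 - l) \<odot> K \<oplus> l \<odot> E)
        = ereal (\<phi> (1 - l) l / (m * d))"
      using ratio[of "1 - l" l] l by auto
    \<comment> \<open>The substitution \<open>t = (1 - l) * (u - s)\<close> maps points right of
      \<open>s\<close> to points right of \<open>0\<close>, as a one-sided derivative
      requires.\<close>
    have img: "(\<lambda>u. (1 - l) * (u - s)) ` {s<..} \<subseteq> {0<..}"
      using l by auto
    have "((\<lambda>t. \<phi> (1 - l) (l + t)) \<circ> (\<lambda>u. (1 - l) * (u - s)) has_real_derivative d * (1 - l)) (at_right s)"
      by (rule DERIV_image_chain)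
        (use DERIV_subset[OF d(2) img] in \<open>auto intro!: derivative_eq_intros\<close>)
    then have "((\<lambda>u. 1 / (1 - l) * \<phi> (1 - l) (l + (1 - l) * (u - s))) has_real_derivative
        1 / (1 - l) * (d * (1 - l))) (at_right s)"
      unfolding o_def by (rule DERIV_cmult)
    moreover have h_eq: "1 / (1 - l) * \<phi> (1 - l) (l + (1 - l) * (u - s)) = h u" if "s \<le> u" for u
    proof -
      have "0 \<le> s" "l + (1 - l) * (u - s) = (1 - l) * u"
        using l l_eq by (auto simp: s_def algebra_simps)
      then show ?thesis
        using \<phi>_hom[of "1 - l" 1 u] l that by (simp add: h_def)
    qed
    moreover have "\<forall>\<^sub>F u in at_right s. 1 / (1 - l) * \<phi> (1 - l) (l + (1 - l) * (u - s)) = h u"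
      using h_eq by (auto simp: eventually_at_right_field intro: exI[of _ "s + 1"])
    ultimately have "(h has_real_derivative d) (at_right s)"
      using l h_eq[of s] by (subst (asm) has_field_derivative_cong_eventually[where g = h]) auto
    moreover have "\<phi> (1 - l) l / (m * d) = (1 - l) / m * (h s / d)"
      using \<phi>_h[of "1 - l" l] l by (simp add: s_def)
    ultimately show ?thesis
      using d(1) eq unfolding s_def by auto
  qed
  obtain d0 where d0: "0 < d0" "(h has_real_derivative d0) (at_right 0)"
    and K_ratio: "ereal (F K) / G K = ereal (h 0 / (m * d0))"
    using ratio_h[of 0] by (auto simp: comb_K)
  define lhs where "lhs t = ereal (F ((1 - t) \<odot> K \<oplus> t \<odot> E)) / G ((1 - t) \<odot> K \<oplus> t \<odot> E)" for t
  define rhs where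
    "rhs t = ereal (1 - t) * (ereal (F K) / G K) + ereal t * (ereal (F E) / G E)" for t
  \<comment> \<open>Since \<open>l = (1 - l) * (l / (1 - l))\<close>, the factor
    \<open>(1 - l) / m\<close> comes out of both sides, leaving the inequality between tangent
    ratios.\<close>
  have rhs_eq: "rhs l = ereal ((1 - l) / m * (h 0 / d0 + l / (1 - l)))" if "l < 1" for l
  proof -
    have "(1 - l) * (h 0 / (m * d0)) + l * (1 / m) = (1 - l) / m * (h 0 / d0 + l / (1 - l))"
      using that m_pos d0(1) by (simp add: distrib_left)
    then show ?thesis
      unfolding rhs_def K_ratio E_ratio by simp
  qed
  \<comment> \<open>The slope \<open>d\<close> is exported together with the equivalence, so that
    the converse can compute it where \<open>h\<close> is affine.\<close>
  have key: "\<exists>d. (h has_real_derivative d) (at_right (l / (1 - l))) \<and> lhs l \<le> rhs l \<and>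
      (lhs l = rhs l \<longleftrightarrow> (\<forall>u\<in>{0..l / (1 - l)}. h u = h 0 + d0 * u) \<and> d = d0)"
    if l: "l \<in> {0<..<1}" for l
  proof -
    obtain d where d: "0 < d" "(h has_real_derivative d) (at_right (l / (1 - l)))"
      and lhs_eq: "lhs l = ereal ((1 - l) / m * (h (l / (1 - l)) / d))"
      using ratio_h[of l] l unfolding lhs_def by auto
    have s: "0 < l / (1 - l)" and c: "0 < (1 - l) / m"
      using l m_pos by auto
    note le = convex_on_tangent_ratio_le[OF h_convex h_pos s d0(2,1) d(2)]
    have "lhs l \<le> rhs l"
      using l mult_left_mono[OF le(1) less_imp_le[OF c]]
      by (simp only: lhs_eq rhs_eq ereal_less_eq greaterThanLessThan_iff)
    moreover have "lhs l = rhs l \<longleftrightarrow> h (l / (1 - l)) / d = h 0 / d0 + l / (1 - l)"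
      unfolding lhs_eq using l c by (subst rhs_eq) (auto simp only: ereal.inject mult_cancel_left greaterThanLessThan_iff)
    ultimately show ?thesis
      using d(2) le(2) by blast
  qed
  have le: "lhs l \<le> rhs l" if "l \<in> {0..1}" for l
  proof -
    consider "l = 0" | "l = 1" | "l \<in> {0<..<1}"
      using \<open>l \<in> {0..1}\<close> by fastforce
    then show ?thesis
    proof cases
      case 1
      then show ?thesis
        by (simp add: lhs_def rhs_def comb_K E_ratio K_ratio)
    next
      case 2
      then show ?thesis
        by (simp add: lhs_def rhs_def comb_E E_ratio K_ratio)
    next
      case 3
      then show ?thesis
        using key by blast
    qed
  qed

  \<comment> \<open>Equality and affine segments\<close>
  define affine_upto where "affine_upto l = affine_fun_on {0..l} (\<lambda>t. \<phi> (1 - t) t)" for l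
  have eq_imp_affine: "affine_upto l" if l: "l \<in> {0<..<1}" and eq: "lhs l = rhs l" for l
  proof -
    have *: "\<forall>u\<in>{0..l / (1 - l)}. h u = h 0 + d0 * u"
      using key[OF l] eq by blast
    \<comment> \<open>The factor \<open>1 - t\<close> clears the denominator in
      \<open>h (t / (1 - t))\<close>, so an affine \<open>h\<close> becomes an affine function of
      \<open>t\<close>.\<close>
    have "\<phi> (1 - t) t = h 0 + (d0 - h 0) * t" if t: "t \<in> {0..l}" for t
    proof -
      have "t / (1 - t) \<in> {0..l / (1 - l)}"
        using t l frac_le[of l t "1 - l" "1 - t"] by simp
      with * have "h (t / (1 - t)) = h 0 + d0 * (t / (1 - t))"
        by (rule bspec)
      then have "\<phi> (1 - t) t = (1 - t) * (h 0 + d0 * (t / (1 - t)))"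
        using \<phi>_h[of "1 - t" t] t l by simp
      also have "\<dots> = (1 - t) * h 0 + d0 * t"
        using t l by (simp add: distrib_left)
      finally show ?thesis
        by (simp add: algebra_simps)
    qed
    then show ?thesis
      unfolding affine_upto_def affine_fun_on_def by blast
  qed
  have affine_imp_eq: "lhs k = rhs k"
    if l: "l \<in> {0<..<1}" and aff: "affine_upto l" and k: "k \<in> {0<..<l}" for k l
  proof -
    obtain a b where ab: "\<And>t. t \<in> {0..l} \<Longrightarrow> \<phi> (1 - t) t = a + b * t"
      using aff unfolding affine_upto_def affine_fun_on_def by blast
    \<comment> \<open>The inverse change of parameter \<open>t = u / (1 + u)\<close> sends
      \<open>[0, l / (1 - l)]\<close> to \<open>[0, l]\<close>, and scaling by \<open>1 + u\<close>
      carries affinity back to \<open>h\<close>.\<close>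
    have h_affine: "h u = a + (a + b) * u" if u: "0 \<le> u" "u \<le> l / (1 - l)" for u
    proof -
      define t where "t = u / (1 + u)"
      have t: "t \<in> {0..l}"
        using u l by (simp add: t_def field_simps)
      have t1: "(1 + u) * (1 - t) = 1" "(1 + u) * t = u"
        using u by (auto simp: t_def field_simps)
      have "h u = (1 + u) * \<phi> (1 - t) t"
        using \<phi>_hom[of "1 + u" "1 - t" t] u t l unfolding t1 h_def by simp
      also have "\<dots> = (1 + u) * a + b * ((1 + u) * t)"
        unfolding ab[OF t] by (simp add: algebra_simps)
      finally show ?thesis
        unfolding t1 by (simp add: algebra_simps)
    qed
    \<comment> \<open>The strict bound on \<open>s\<close> leaves room to its right in which
      \<open>h\<close> is still affine, so the right derivative is the common slope. Here
      \<open>k < l\<close> enters.\<close>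
    have deriv: "d = a + b"
      if s: "0 \<le> s" "s < l / (1 - l)" and d: "(h has_real_derivative d) (at_right s)" for s d
    proof -
      have "\<forall>\<^sub>F u in at_right s. h u = a + (a + b) * u"
        using s h_affine by (auto simp: eventually_at_right_field intro!: exI[of _ "l / (1 - l)"])
      moreover have "h s = a + (a + b) * s"
        using s h_affine by simp
      ultimately have "((\<lambda>u. a + (a + b) * u) has_real_derivative d) (at_right s)"
        using d by (subst (asm) has_field_derivative_cong_eventually)
      moreover have "((\<lambda>u. a + (a + b) * u) has_real_derivative a + b) (at_right s)"
        by (auto intro!: derivative_eq_intros)
      ultimately show ?thesis
        by (rule has_field_derivative_unique) simp
    qed
    have k1: "k \<in> {0<..<1}" and s: "0 < k / (1 - k)" "k / (1 - k) < l / (1 - l)"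
      using k l frac_less[of k l "1 - l" "1 - k"] by auto
    obtain d where d: "(h has_real_derivative d) (at_right (k / (1 - k)))"
      and iff: "lhs k = rhs k \<longleftrightarrow> (\<forall>u\<in>{0..k / (1 - k)}. h u = h 0 + d0 * u) \<and> d = d0"
      using key[OF k1] by blast
    have "d0 = a + b" "d = a + b"
      using deriv[OF _ _ d0(2)] deriv[OF _ _ d] s by auto
    moreover have "h 0 = a"
      using h_affine[of 0] s by simp
    ultimately show ?thesis
      unfolding iff using h_affine s by auto
  qed
  have "(\<exists>l\<in>{0<..<1}. lhs l = rhs l) \<longleftrightarrow> (\<exists>l\<in>{0<..<1}. affine_upto l)"
  proof
    assume "\<exists>l\<in>{0<..<1}. lhs l = rhs l"
    then show "\<exists>l\<in>{0<..<1}. affine_upto l"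
      using eq_imp_affine by blast
  next
    assume "\<exists>l\<in>{0<..<1}. affine_upto l"
    then obtain l :: real where l: "l \<in> {0<..<1}" "affine_upto l"
      by blast
    \<comment> \<open>Equality is derived only strictly below \<open>l\<close>, so half of
      \<open>l\<close> serves as witness.\<close>
    then have "l / 2 \<in> {0<..<l}" "l / 2 \<in> {0<..<1}"
      by auto
    then show "\<exists>l\<in>{0<..<1}. lhs l = rhs l"
      using affine_imp_eq[OF l] by blast
  qed
  with le eq_imp_affine affine_imp_eq show ?thesis
    unfolding Let_def lhs_def rhs_def affine_upto_def \<phi>_def G_def by blast
qed

end
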